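(* Let $n\ge1$ and let $P$ and $Q$ be two complex polynomials of degree $n$. Then $$V(P\boxplus_n^{\Delta}Q)\subseteq V(P)+V(Q)-\frac{n-1}{2}.$$
   Context: $\Delta P(t)=P(t+1)-P(t)$ is the forward difference operator. For complex polynomials $A,B$ of degree at most $n$, $(A\boxplus_n^{\Delta}B)(z)=\frac1{n!}\sum_{k=0}^n(\Delta^kA)(0)\,(\Delta^{n-k}B)(z)$. For $-\infty\le a\le b\le+\infty$ put $V(a,b)=\{z\in\mathbb{C}: a\le\mathrm{Re}(z)\le b\}$. For a nonconstant polynomial $P$, $V(P)$ denotes the smallest strip $V(a,b)$ containing all roots of $P$ (so $a$ and $b$ are the minimum and maximum of the real parts of the roots). The right-hand side is the Minkowski sum of the two strips translated by $-\frac{n-1}{2}$. *)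

theory Defs
  imports
    Complex_Main
    "HOL-Library.Extended_Real"
    "HOL-Library.Set_Algebras"
    "HOL-Computational_Algebra.Fundamental_Theorem_Algebra"
begin

definition fwd_diff :: "'a::comm_ring_1 poly \<Rightarrow> 'a poly" where
  "fwd_diff P = pcompose P [:1, 1:] - P"

lemma poly_fwd_diff: "poly (fwd_diff P) t = poly P (t + 1) - poly P t"
  by (simp add: fwd_diff_def poly_pcompose add.commute)

text \<open>The convolution is meant for polynomials of degree at most \<open>n\<close>.\<close>

definition diff_conv :: "nat \<Rightarrow> complex poly \<Rightarrow> complex poly \<Rightarrow> complex poly" where
  "diff_conv n A B =
     smult (1 / fact n)
       (\<Sum>k=0..n. smult (poly ((fwd_diff ^^ k) A) 0) ((fwd_diff ^^ (n - k)) B))"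

lemma poly_diff_conv:
  "poly (diff_conv n A B) z =
     1 / fact n * (\<Sum>k=0..n. poly ((fwd_diff ^^ k) A) 0 * poly ((fwd_diff ^^ (n - k)) B) z)"
  by (simp add: diff_conv_def poly_sum)

definition strip :: "ereal \<Rightarrow> ereal \<Rightarrow> complex set" where
  "strip a b = {z. a \<le> ereal (Re z) \<and> ereal (Re z) \<le> b}"

text \<open>The smallest strip containing all roots, as the intersection of all such strips. For
  nonconstant \<open>P\<close> it is itself a strip, see \<open>root_strip_eq\<close>; it carries no meaning
  for constant \<open>P\<close>.\<close>

definition root_strip :: "complex poly \<Rightarrow> complex set" where
  "root_strip P = \<Inter> {strip a b | a b. a \<le> b \<and> {z. poly P z = 0} \<subseteq> strip a b}"

lemma root_strip_eq:
  assumes "degree P > 0"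
  shows "root_strip P =
    strip (ereal (Min (Re ` {z. poly P z = 0}))) (ereal (Max (Re ` {z. poly P z = 0})))"
    (is "_ = strip (ereal ?m) (ereal ?M)")
proof -
  let ?R = "{z. poly P z = 0}"
  have fin: "finite (Re ` ?R)"
    using assms by (intro finite_imageI poly_roots_finite) auto
  have ne: "Re ` ?R \<noteq> {}"
    using assms fundamental_theorem_of_algebra[of P] by (auto simp: constant_degree)
  have le: "?m \<le> ?M"
    using Min_in[OF fin ne] Max_ge[OF fin] by blast
  have sub: "?R \<subseteq> strip (ereal ?m) (ereal ?M)"
    using fin by (auto simp: strip_def)
  show ?thesis
  proof (rule antisym)
    show "root_strip P \<subseteq> strip (ereal ?m) (ereal ?M)"
      unfolding root_strip_def
    proof (rule Inter_lower, rule CollectI, intro exI conjI)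
      show "ereal ?m \<le> ereal ?M" using le by simp
    qed (rule refl sub)+
    show "strip (ereal ?m) (ereal ?M) \<subseteq> root_strip P"
    proof
      fix z assume z: "z \<in> strip (ereal ?m) (ereal ?M)"
      show "z \<in> root_strip P"
        unfolding root_strip_def
      proof clarify
        fix a b assume R: "?R \<subseteq> strip a b"
        obtain u v where "u \<in> ?R" "Re u = ?m" "v \<in> ?R" "Re v = ?M"
          using Min_in[OF fin ne] Max_in[OF fin ne] by (metis (no_types, lifting) imageE)
        with R have "a \<le> ereal ?m" "ereal ?M \<le> b"
          by (force simp: strip_def)+
        with z show "z \<in> strip a b"
          unfolding strip_def by (blast intro: order_trans)
      qed
    qed
  qed
qed

end

theory Submission imports Defs begin

text \<open>The argument is a discrete analogue of Grace's theorem. Splitting a linear factor off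
  \<open>A = (x - a) R\<close> turns the value at \<open>z\<close> of the convolution of \<open>A\<close> and \<open>B\<close> in degree \<open>n\<close>
  into that of \<open>R\<close> and a discrete polar derivative \<open>n B - (x - c) \<Delta> B\<close> in degree \<open>n - 1\<close>, where
  \<open>c = z + n - 1 - a\<close>. As in Laguerre's theorem, if the roots of \<open>B\<close> have real part at most \<open>b\<close>
  and \<open>Re c > b + (n - 1) / 2\<close>, then the polar derivative has degree exactly \<open>n - 1\<close> and its
  roots have real part at most \<open>b - 1/2\<close>. By induction on \<open>n\<close> the convolution does not vanish at
  any \<open>z\<close> to the right of the claimed strip. The sign \<open>s\<close> below treats both sides at once.\<close>

section \<open>Algebra of the forward difference\<close>

lemma fwd_diff_add: "fwd_diff (P + Q) = fwd_diff P + fwd_diff Q"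
  by (simp add: fwd_diff_def pcompose_add)

lemma fwd_diff_diff: "fwd_diff (P - Q) = fwd_diff P - fwd_diff Q"
  by (simp add: fwd_diff_def pcompose_diff)

lemma fwd_diff_smult: "fwd_diff (smult c P) = smult c (fwd_diff P)"
  by (simp add: fwd_diff_def pcompose_smult smult_diff_right)

lemma fwd_diff_0 [simp]: "fwd_diff 0 = 0"
  by (simp add: fwd_diff_def)

lemma fwd_diff_linear_mult:
  "fwd_diff ([:-a, 1:] * P) = [:1 - a, 1:] * fwd_diff P + P"
proof -
  have "[:-a, 1:] \<circ>\<^sub>p [:1, 1:] = [:-a, 1:] + 1" "[:1 - a, 1:] = [:-a, 1:] + 1"
    by (simp_all add: pcompose_pCons one_pCons)
  then show ?thesis
    unfolding fwd_diff_def pcompose_mult by (simp add: algebra_simps del: mult_pCons_left)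
qed

lemma funpow_fwd_diff_diff:
  "(fwd_diff ^^ k) (P - Q) = (fwd_diff ^^ k) P - (fwd_diff ^^ k) Q"
  by (induction k) (auto simp: fwd_diff_diff)

lemma funpow_fwd_diff_smult:
  "(fwd_diff ^^ k) (smult c P) = smult c ((fwd_diff ^^ k) P)"
  by (induction k) (auto simp: fwd_diff_smult)

text \<open>The Leibniz rule for \<Delta> stops after two terms, since the second difference of a
  linear factor vanishes. At \<open>k = 0\<close> the truncated \<open>k - 1\<close> is harmless
  because its coefficient is 0.\<close>

lemma funpow_fwd_diff_linear_mult:
  "(fwd_diff ^^ k) ([:-a, 1:] * P) =
     [:of_nat k - a, 1:] * (fwd_diff ^^ k) P + smult (of_nat k) ((fwd_diff ^^ (k - 1)) P)"
proof (induction k)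
  case (Suc k)
  have "fwd_diff ([:of_nat k - a, 1:] * (fwd_diff ^^ k) P) =
      [:of_nat (Suc k) - a, 1:] * (fwd_diff ^^ Suc k) P + (fwd_diff ^^ k) P"
    using fwd_diff_linear_mult[of "a - of_nat k" "(fwd_diff ^^ k) P"]
    by (simp add: algebra_simps)
  moreover have "smult (of_nat k) (fwd_diff ((fwd_diff ^^ (k - 1)) P)) =
      smult (of_nat k) ((fwd_diff ^^ k) P)"
    by (cases k) auto
  ultimately show ?case
    using Suc by (simp add: fwd_diff_add fwd_diff_smult smult_add_left algebra_simps)
qed simp

lemma complex_poly_root_factor:
  fixes P :: "complex poly"
  assumes "degree P = Suc n"
  obtains r R where "P = [:-r, 1:] * R" "degree R = n" "lead_coeff R = lead_coeff P"
proof -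
  obtain r where "poly P r = 0"
    using fundamental_theorem_of_algebra[of P] assms by (auto simp: constant_degree)
  then obtain R where R: "P = [:-r, 1:] * R"
    by (auto simp: poly_eq_0_iff_dvd)
  with assms have "R \<noteq> 0" by auto
  with R assms have "degree R = n"
    by (simp add: degree_mult_eq del: mult_pCons_left)
  moreover have "lead_coeff R = lead_coeff P"
    unfolding R lead_coeff_mult by simp
  ultimately show thesis
    using that R by blast
qed

lemma funpow_fwd_diff_degree:
  fixes P :: "complex poly"
  assumes "degree P = n"
  shows "(fwd_diff ^^ Suc n) P = 0"
  using assms
proof (induction n arbitrary: P)
  case 0
  then obtain c where "P = [:c:]" using degree_eq_zeroE by blast
  then show ?case by (simp add: fwd_diff_def)
next
  case (Suc n)
  from Suc.prems obtain r R where P: "P = [:-r, 1:] * R" and R: "degree R = n"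
    by (rule complex_poly_root_factor)
  have "(fwd_diff ^^ Suc n) R = 0" by (rule Suc.IH[OF R])
  then show ?case
    unfolding P funpow_fwd_diff_linear_mult by simp
qed

section \<open>The discrete polar derivative and the convolution\<close>

definition diff_polar :: "nat \<Rightarrow> complex \<Rightarrow> complex poly \<Rightarrow> complex poly" where
  "diff_polar n c B = smult (of_nat n) B - [:-c, 1:] * fwd_diff B"

lemma poly_diff_polar:
  "poly (diff_polar n c B) x = (of_nat n + x - c) * poly B x - (x - c) * poly B (x + 1)"
  by (simp add: diff_polar_def poly_fwd_diff algebra_simps)

lemma poly_funpow_diff_polar:
  "poly ((fwd_diff ^^ m) (diff_polar n c B)) z =
     (of_nat n - of_nat m) * poly ((fwd_diff ^^ m) B) z
     - (z - c + of_nat m) * poly ((fwd_diff ^^ Suc m) B) z"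
proof -
  \<comment> \<open>Only for \<open>m = 0\<close> do the two iterates differ, and there both sides
    carry the factor 0.\<close>
  have "smult (of_nat m) ((fwd_diff ^^ (m - 1)) (fwd_diff B)) =
      smult (of_nat m) ((fwd_diff ^^ m) B)"
    by (cases m) (auto simp: funpow_swap1)
  moreover have "(fwd_diff ^^ m) (fwd_diff B) = (fwd_diff ^^ Suc m) B"
    by (simp add: funpow_swap1)
  ultimately show ?thesis
    unfolding diff_polar_def funpow_fwd_diff_diff funpow_fwd_diff_smult
      funpow_fwd_diff_linear_mult
    by (simp add: algebra_simps del: funpow.simps)
qed

text \<open>After the Leibniz rule, \<Delta>^k R (0) is multiplied by (k - a) \<Delta>^(n+1-k) B (z)
  + (k + 1) \<Delta>^(n-k) B (z). This is the (n-k)-th difference of the polar derivative at z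
  precisely because c = z + n - a; the pole thus depends on z, and the identity is pointwise. The
  divisor \<open>Suc n\<close> comes from the two factorials.\<close>

lemma poly_diff_conv_linear_mult:
  assumes "degree R = n"
  shows "poly (diff_conv (Suc n) ([:-a, 1:] * R) B) z =
    poly (diff_conv n R (diff_polar (Suc n) (z + of_nat n - a) B)) z / of_nat (Suc n)"
proof -
  define u where "u k = poly ((fwd_diff ^^ k) R) 0" for k
  define v where "v k = poly ((fwd_diff ^^ k) B) z" for k
  \<comment> \<open>This removes the top term, so that both sums end up with the range
    \<open>{0..n}\<close>.\<close>
  have u0: "u (Suc n) = 0"
    by (simp only: u_def funpow_fwd_diff_degree[OF assms] poly_0)
  have "(\<Sum>k=0..Suc n. poly ((fwd_diff ^^ k) ([:-a, 1:] * R)) 0 * v (Suc n - k)) =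
      (\<Sum>k=0..Suc n. (of_nat k - a) * u k * v (Suc n - k)) +
      (\<Sum>k=0..Suc n. of_nat k * u (k - 1) * v (Suc n - k))"
    unfolding funpow_fwd_diff_linear_mult
    by (simp add: u_def sum.distrib[symmetric] algebra_simps del: sum.op_ivl_Suc)
  also have "(\<Sum>k=0..Suc n. (of_nat k - a) * u k * v (Suc n - k)) =
      (\<Sum>k=0..n. (of_nat k - a) * u k * v (Suc n - k))"
    by (simp add: u0)
  also have "(\<Sum>k=0..Suc n. of_nat k * u (k - 1) * v (Suc n - k)) =
      (\<Sum>k=0..n. of_nat (Suc k) * u k * v (n - k))"
    by (subst sum.atLeast0_atMost_Suc_shift) simp
  also have "(\<Sum>k=0..n. (of_nat k - a) * u k * v (Suc n - k)) +
      (\<Sum>k=0..n. of_nat (Suc k) * u k * v (n - k)) =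
      (\<Sum>k=0..n. u k *
         poly ((fwd_diff ^^ (n - k)) (diff_polar (Suc n) (z + of_nat n - a) B)) z)"
    unfolding sum.distrib[symmetric]
  proof (rule sum.cong)
    fix k assume "k \<in> {0..n}"
    then have k: "k \<le> n" by simp
    show "(of_nat k - a) * u k * v (Suc n - k) + of_nat (Suc k) * u k * v (n - k) =
      u k * poly ((fwd_diff ^^ (n - k)) (diff_polar (Suc n) (z + of_nat n - a) B)) z"
      unfolding poly_funpow_diff_polar using k
      by (simp add: v_def[symmetric] Suc_diff_le of_nat_diff algebra_simps
          flip: funpow.simps(2))
  qed simp
  finally show ?thesis
    by (simp add: poly_diff_conv u_def v_def field_simps del: sum.op_ivl_Suc)
qed

section \<open>Degree and top coefficient of the polar derivative\<close>

lemma diff_polar_linear_mult: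
  "diff_polar (Suc n) c ([:-r, 1:] * R) =
     [:1 - r, 1:] * diff_polar n c R + smult (c - r - of_nat n) R"
  unfolding poly_eq_poly_eq_iff[symmetric]
  by (rule ext) (simp add: poly_diff_polar algebra_simps)

text \<open>The terms of degree n cancel. The k-th linear factor, counted from 0, adds c - r - k to
  \<open>\<mu>\<close>, so in total \<open>\<mu>\<close> is n c minus the sum of the roots minus n
  (n - 1) / 2; bounding each root by \<open>b\<close> gives the estimate.\<close>

lemma diff_polar_top_coeff:
  fixes s b :: real
  assumes "degree B = n" and "\<And>r. poly B r = 0 \<Longrightarrow> s * Re r \<le> b"
  shows "degree (diff_polar n c B) \<le> n - 1 \<and>
    (\<exists>\<mu>. coeff (diff_polar n c B) (n - 1) = lead_coeff B * \<mu> \<and>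
       s * Re \<mu> \<ge> real n * (s * Re c - b - s * (real n - 1) / 2))"
  using assms
proof (induction n arbitrary: B)
  case 0
  then obtain d where "B = [:d:]" using degree_eq_zeroE by blast
  then have "diff_polar 0 c B = 0" by (simp add: diff_polar_def fwd_diff_def)
  then show ?case by (auto intro: exI[of _ 0])
next
  case (Suc n)
  from Suc.prems(1) obtain r R where B: "B = [:-r, 1:] * R" and R: "degree R = n"
    and lc: "lead_coeff R = lead_coeff B"
    by (rule complex_poly_root_factor)
  have r: "s * Re r \<le> b" by (rule Suc.prems(2)) (simp add: B)
  have "s * Re t \<le> b" if "poly R t = 0" for t
    by (rule Suc.prems(2)) (simp add: B that)
  from Suc.IH[OF R this] obtain \<mu> where
    deg: "degree (diff_polar n c R) \<le> n - 1" and
    co: "coeff (diff_polar n c R) (n - 1) = lead_coeff R * \<mu>" and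
    \<mu>: "s * Re \<mu> \<ge> real n * (s * Re c - b - s * (real n - 1) / 2)" by blast
  define T where "T = diff_polar n c R"
  \<comment> \<open>For \<open>n = 0\<close> the index \<open>n - 1\<close> is truncated and no
    longer lies one below \<open>n\<close>; there \<open>T = 0\<close> contributes nothing.\<close>
  define \<nu> where "\<nu> = (if n = 0 then 0 else \<mu>) + (c - r - of_nat n)"
  have T0: "T = 0" if "n = 0"
    using R that by (auto simp: T_def diff_polar_def fwd_diff_def elim!: degree_eq_zeroE)
  have dT: "degree ([:1 - r, 1:] * T) \<le> n"
    using deg T0 degree_mult_le[of "[:1 - r, 1:]" T] by (cases n) (auto simp: T_def)
  have cT: "coeff ([:1 - r, 1:] * T) n = lead_coeff R * (if n = 0 then 0 else \<mu>)"
  proof (cases n)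
    case 0
    then show ?thesis using T0 by simp
  next
    case (Suc k)
    then have "coeff T n = 0" using deg by (simp add: T_def coeff_eq_0)
    then show ?thesis using co Suc by (simp add: T_def)
  qed
  have TB: "diff_polar (Suc n) c B = [:1 - r, 1:] * T + smult (c - r - of_nat n) R"
    unfolding B diff_polar_linear_mult T_def ..
  have "degree (diff_polar (Suc n) c B) \<le> n"
    unfolding TB using dT R degree_smult_le[of "c - r - of_nat n" R] by (intro degree_add_le) auto
  moreover have "coeff (diff_polar (Suc n) c B) n = lead_coeff B * \<nu>"
    unfolding TB coeff_add cT using lc R by (simp add: \<nu>_def algebra_simps)
  moreover have "s * Re \<nu> \<ge>
      real (Suc n) * (s * Re c - b - s * (real (Suc n) - 1) / 2)"
  proof -
    have "s * Re (if n = 0 then 0 else \<mu>) \<ge> real n * (s * Re c - b - s * (real n - 1) / 2)"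
      using \<mu> by auto
    then show ?thesis using r by (simp add: \<nu>_def field_simps)
  qed
  ultimately show ?case by auto
qed

section \<open>Laguerre-type location of the roots\<close>

text \<open>Without m/4 this is the harmonic mean of p with weight 1 and q with weight m, which
  stays in the half plane because inversion maps it to a disc, a convex set. The extra term is a
  nonnegative multiple of 1/w with Re w > 0, so it does not lower the real part.\<close>

lemma Re_harmonic_mean_ge:
  fixes p q :: complex and m :: nat
  assumes "0 < d" "d \<le> Re p" "d \<le> Re q"
  shows "d \<le> Re ((of_nat m + 1) * (q * p + of_nat m / 4) / (of_nat m * p + q))"
proof -
  define w where "w = of_nat m * p + q"
  have "Re w > 0" using assms by (simp add: w_def add_nonneg_pos)
  then have w: "(cmod w)\<^sup>2 > 0" by auto
  \<comment> \<open>The defect in the weighted Cauchy-Schwarz inequality, written out.\<close>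
  have "(cmod w)\<^sup>2 + real m * (cmod (p - q))\<^sup>2 =
      (real m + 1) * (real m * (cmod p)\<^sup>2 + (cmod q)\<^sup>2)"
    unfolding w_def cmod_power2 by (simp add: power2_eq_square algebra_simps)
  then have "(cmod w)\<^sup>2 \<le> (real m + 1) * (real m * (cmod p)\<^sup>2 + (cmod q)\<^sup>2)"
    by (smt (verit) mult_nonneg_nonneg of_nat_0_le_iff zero_le_power2)
  then have "d * (cmod w)\<^sup>2 \<le> d * ((real m + 1) * (real m * (cmod p)\<^sup>2 + (cmod q)\<^sup>2))"
    using \<open>d > 0\<close> by simp
  also have "\<dots> = (real m + 1) * (real m * ((cmod p)\<^sup>2 * d) + (cmod q)\<^sup>2 * d)"
    by (simp add: algebra_simps)
  also have "\<dots> \<le> (real m + 1) * (real m * ((cmod p)\<^sup>2 * Re q) + (cmod q)\<^sup>2 * Re p)"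
    using assms by (intro mult_left_mono add_mono) auto
  also have "\<dots> \<le> \<dots> + (real m + 1) * real m / 4 * Re w"
    using \<open>Re w > 0\<close> by simp
  also have "\<dots> = Re ((of_nat m + 1) * (q * p + of_nat m / 4) * cnj w)"
    unfolding w_def cmod_power2 by (simp add: power2_eq_square algebra_simps)
  finally show ?thesis
    unfolding w_def[symmetric] complex_div_cnj[of _ w] using w
    by (simp add: pos_le_divide_eq flip: of_real_power)
qed

text \<open>Each linear factor of \<open>B\<close> contributes \<open>(p + 1/2) / (p - 1/2)\<close>, with \<open>p = x - r + 1/2\<close>, to
  the quotient of \<open>B (x + 1)\<close> by \<open>B x\<close>. Such quotients combine by the addition theorem of the
  hyperbolic cotangent; the factor \<open>l\<close> avoids a special treatment of the roots of \<open>B\<close>.\<close>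

lemma poly_shift_mean:
  fixes s d :: real
  assumes "s = 1 \<or> s = -1" "d > 0" "degree B = n" "B \<noteq> 0"
    and "\<And>r. poly B r = 0 \<Longrightarrow> d \<le> s * Re (x - r + 1/2)"
  shows "\<exists>l q. l \<noteq> 0 \<and> d \<le> s * Re q \<and>
    poly B (x + 1) = l * (q + of_nat n / 2) \<and> poly B x = l * (q - of_nat n / 2)"
  using assms(3-5)
proof (induction n arbitrary: B)
  case 0
  then obtain e where e: "B = [:e:]" using degree_eq_zeroE by blast
  \<comment> \<open>Since s^2 = 1, the witness q = s d attains the bound, and l is then forced by l
    q = e.\<close>
  show ?case
    using 0 assms(1,2) e by (intro exI[of _ "e / (s * d)"] exI[of _ "of_real (s * d)"]) auto
next
  case (Suc n)
  from Suc.prems(1) obtain r R where B: "B = [:-r, 1:] * R" and R: "degree R = n"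
    by (rule complex_poly_root_factor)
  define p where "p = x - r + 1/2"
  have p: "d \<le> s * Re p" unfolding p_def by (rule Suc.prems(3)) (simp add: B)
  have "d \<le> s * Re (x - t + 1/2)" if "poly R t = 0" for t
    by (rule Suc.prems(3)) (simp add: B that)
  moreover have "R \<noteq> 0" using B Suc.prems(2) by auto
  ultimately obtain l q where l: "l \<noteq> 0" and q: "d \<le> s * Re q" and
    R1: "poly R (x + 1) = l * (q + of_nat n / 2)" and R0: "poly R x = l * (q - of_nat n / 2)"
    using Suc.IH[OF R] by blast
  \<comment> \<open>The products (p + 1/2)(q + n/2) and (p - 1/2)(q - n/2) equal (p q + n/4) plus or
    minus w/2. Matching them with \<open>l' * (q' + of_nat (Suc n) / 2)\<close> and its counterpart
    determines \<open>l'\<close> and \<open>q'\<close>.\<close>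
  define w where "w = of_nat n * p + q"
  define q' where "q' = (of_nat n + 1) * (q * p + of_nat n / 4) / w"
  define l' where "l' = l * w / (of_nat n + 1)"
  have "0 < real n * (s * Re p) + s * Re q"
    using p q \<open>d > 0\<close> by (intro add_nonneg_pos) auto
  also have "\<dots> = s * Re w" by (simp add: w_def algebra_simps)
  finally have w: "w \<noteq> 0" by auto
  have n1: "of_nat n + 1 \<noteq> (0::complex)"
    by (metis of_nat_Suc of_nat_neq_0 add.commute)
  have BR1: "poly B (x + 1) = (p + 1/2) * poly R (x + 1)"
    by (simp add: B p_def algebra_simps)
  have BR0: "poly B x = (p - 1/2) * poly R x"
    by (simp add: B p_def algebra_simps)
  have l'q': "l' * q' = l * (q * p + of_nat n / 4)"
    using w n1 by (simp add: l'_def q'_def)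
  have l'n: "l' * (of_nat (Suc n) / 2) = l * w / 2"
    using n1 by (simp add: l'_def add.commute)
  \<comment> \<open>Scaling p and q by s leaves the numerator fixed and turns w into s w, hence q'
    into s q'.\<close>
  have "d \<le> Re ((of_nat n + 1) * ((s * q) * (s * p) + of_nat n / 4) /
      (of_nat n * (s * p) + s * q))"
    using p q \<open>d > 0\<close> by (intro Re_harmonic_mean_ge) auto
  also have "\<dots> = s * Re q'"
  proof -
    have "of_nat n * (s * p) + s * q = s * w" by (simp add: w_def algebra_simps)
    then show ?thesis using assms(1) by (auto simp: q'_def)
  qed
  finally have "d \<le> s * Re q'" .
  moreover have "poly B (x + 1) = l' * (q' + of_nat (Suc n) / 2)"
    unfolding distrib_left l'q' l'n
    unfolding BR1 R1 by (simp add: w_def field_simps)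
  moreover have "poly B x = l' * (q' - of_nat (Suc n) / 2)"
    unfolding right_diff_distrib l'q' l'n
    unfolding BR0 R0 by (simp add: w_def field_simps)
  moreover have "l' \<noteq> 0" using l w n1 by (simp add: l'_def)
  ultimately show ?case by blast
qed

text \<open>By \<open>poly_shift_mean\<close> the value at x is l n (q - n/2 - x + c), so a root
  forces q = x - c + n/2. For x beyond the bound, the estimate on q then contradicts the position of
  c.\<close>

lemma diff_polar_roots:
  fixes s b :: real
  assumes s: "s = 1 \<or> s = -1" and B: "degree B = n" "n > 0"
    and roots: "\<And>r. poly B r = 0 \<Longrightarrow> s * Re r \<le> b"
    and c: "s * Re c > b + s * (real n - 1) / 2"
    and x: "poly (diff_polar n c B) x = 0"
  shows "s * Re x \<le> b - s / 2"
proof (rule ccontr)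
  \<comment> \<open>This is the least value that s Re (x - r + 1/2) can take for a root r; it is
    positive exactly when the claim fails.\<close>
  define d where "d = s * Re x - b + s / 2"
  assume "\<not> ?thesis"
  then have d: "d > 0" by (simp add: d_def)
  have "d \<le> s * Re (x - r + 1/2)" if "poly B r = 0" for r
    using roots[OF that] by (simp add: d_def algebra_simps)
  moreover have "B \<noteq> 0" using B by auto
  ultimately obtain l q where l: "l \<noteq> 0" and q: "d \<le> s * Re q" and
    B1: "poly B (x + 1) = l * (q + of_nat n / 2)" and B0: "poly B x = l * (q - of_nat n / 2)"
    using poly_shift_mean[OF s d B(1)] by blast
  have "poly (diff_polar n c B) x = l * of_nat n * (q - of_nat n / 2 - x + c)"
    unfolding poly_diff_polar B1 B0 by (simp add: field_simps)
  then have "q - of_nat n / 2 - x + c = 0"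
    using x l B(2) by simp
  then have "q = x - c + of_nat n / 2"
    by (metis add_diff_eq diff_add_cancel diff_add_eq eq_iff_diff_eq_0)
  then have Rq: "Re q = Re x - Re c + real n / 2" by simp
  have "s * Re q = s * Re x - s * Re c + s * real n / 2"
    unfolding Rq by (simp add: algebra_simps)
  then show False using q c by (simp add: d_def field_simps)
qed

text \<open>The position of c makes the lower bound for s Re \<open>\<mu>\<close> positive, so the
  top coefficient survives. The second conclusion is stated separately because for n = 1 the degree
  alone does not exclude the zero polynomial.\<close>

lemma degree_diff_polar:
  fixes s b :: real
  assumes B: "degree B = n" "n > 0"
    and roots: "\<And>r. poly B r = 0 \<Longrightarrow> s * Re r \<le> b"
    and c: "s * Re c > b + s * (real n - 1) / 2"
  shows "degree (diff_polar n c B) = n - 1" "diff_polar n c B \<noteq> 0"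
proof -
  obtain \<mu> where deg: "degree (diff_polar n c B) \<le> n - 1"
    and co: "coeff (diff_polar n c B) (n - 1) = lead_coeff B * \<mu>"
    and \<mu>: "s * Re \<mu> \<ge> real n * (s * Re c - b - s * (real n - 1) / 2)"
    using diff_polar_top_coeff[OF B(1) roots] by blast
  have "real n * (s * Re c - b - s * (real n - 1) / 2) > 0"
    using B(2) c by (intro mult_pos_pos) auto
  with \<mu> have "\<mu> \<noteq> 0" by auto
  moreover have "lead_coeff B \<noteq> 0" using B by auto
  ultimately have "coeff (diff_polar n c B) (n - 1) \<noteq> 0" using co by simp
  then show "degree (diff_polar n c B) = n - 1" "diff_polar n c B \<noteq> 0"
    using deg le_degree by (fastforce, force)
qed

section \<open>Induction on the degree\<close>

lemma diff_conv_nonzero: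
  fixes s a b :: real
  assumes s: "s = 1 \<or> s = -1"
    and "degree A = n" "degree B = n" "A \<noteq> 0" "B \<noteq> 0"
    and "\<And>r. poly A r = 0 \<Longrightarrow> s * Re r \<le> a"
    and "\<And>r. poly B r = 0 \<Longrightarrow> s * Re r \<le> b"
    and "s * Re z > a + b - s * (real n - 1) / 2"
  shows "poly (diff_conv n A B) z \<noteq> 0"
  using assms(2-)
proof (induction n arbitrary: A B b)
  case 0
  then obtain e f where "A = [:e:]" "B = [:f:]" by (metis degree_eq_zeroE)
  then show ?case using 0 by (auto simp: poly_diff_conv)
next
  case (Suc n)
  from Suc.prems(1) obtain r R where A: "A = [:-r, 1:] * R" and R: "degree R = n"
    by (rule complex_poly_root_factor)
  have r: "s * Re r \<le> a" by (rule Suc.prems(5)) (simp add: A)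
  define c where "c = z + of_nat n - r"
  \<comment> \<open>The root r contributes at most a, and s n - s n / 2 = s n / 2 is the shift that
    the polar derivative requires.\<close>
  have c: "s * Re c > b + s * (real (Suc n) - 1) / 2"
    using r Suc.prems(7) by (simp add: c_def field_simps)
  let ?T = "diff_polar (Suc n) c B"
  note T = degree_diff_polar[OF Suc.prems(2) _ Suc.prems(6) c]
  have "poly (diff_conv n R ?T) z \<noteq> 0"
  \<comment> \<open>Lowering b by s/2 offsets the change of the shift from s n / 2 to s (n - 1) / 2,
    so the half plane for z stays the same.\<close>
  proof (rule Suc.IH[where b = "b - s / 2"])
    show "s * Re t \<le> a" if "poly R t = 0" for t
      by (rule Suc.prems(5)) (simp add: A that)
    show "s * Re t \<le> b - s / 2" if "poly ?T t = 0" for t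
      using diff_polar_roots[OF s Suc.prems(2) _ Suc.prems(6) c that] by simp
    show "a + (b - s / 2) - s * (real n - 1) / 2 < s * Re z"
      using Suc.prems(7) by (simp add: field_simps)
    show "R \<noteq> 0" using A Suc.prems(3) by auto
  qed (use R T in auto)
  then show ?case
    unfolding A poly_diff_conv_linear_mult[OF R] c_def[symmetric]
    by (simp del: of_nat_Suc)
qed

section \<open>From half planes to strips\<close>

lemma strip_add:
  assumes "a \<le> b" "c \<le> d"
  shows "strip (ereal (a + c)) (ereal (b + d)) \<subseteq>
    strip (ereal a) (ereal b) + strip (ereal c) (ereal d)"
proof
  fix z assume z: "z \<in> strip (ereal (a + c)) (ereal (b + d))"
  \<comment> \<open>The intervals [a, b] and [Re z - d, Re z - c] meet, and t is the left end of
    their intersection; the imaginary part of z goes into the second summand.\<close>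
  define t where "t = max a (Re z - d)"
  have "of_real t \<in> strip (ereal a) (ereal b)" "z - of_real t \<in> strip (ereal c) (ereal d)"
    using z assms by (auto simp: strip_def t_def)
  then have "of_real t + (z - of_real t) \<in> strip (ereal a) (ereal b) + strip (ereal c) (ereal d)"
    by (rule set_plus_intro)
  then show "z \<in> strip (ereal a) (ereal b) + strip (ereal c) (ereal d)" by simp
qed

theorem theorem1p9:
  fixes n :: nat and P Q :: "complex poly"
  assumes "n \<ge> 1"
    and "degree P = n"
    and "degree Q = n"
  shows "root_strip (diff_conv n P Q)
    \<subseteq> (\<lambda>z. z - of_real ((real n - 1) / 2)) ` (root_strip P + root_strip Q)"
proof -
  have bounds: "\<exists>a b. a \<le> b \<and> root_strip A = strip (ereal a) (ereal b) \<and>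
      (\<forall>r. poly A r = 0 \<longrightarrow> a \<le> Re r \<and> Re r \<le> b)" if "degree A > 0" for A
  proof -
    let ?S = "Re ` {z. poly A z = 0}"
    have fin: "finite ?S"
      using that by (intro finite_imageI poly_roots_finite) auto
    have "\<exists>w. poly A w = 0"
      using that fundamental_theorem_of_algebra[of A] by (simp add: constant_degree)
    then obtain w where "poly A w = 0" ..
    then have "Min ?S \<le> Re w" "Re w \<le> Max ?S" using fin by auto
    then have "Min ?S \<le> Max ?S" by simp
    then show ?thesis using root_strip_eq[OF that] fin by fastforce
  qed
  obtain a b where ab: "a \<le> b" and P: "root_strip P = strip (ereal a) (ereal b)"
    and rP: "\<And>r. poly P r = 0 \<Longrightarrow> a \<le> Re r \<and> Re r \<le> b"
    using bounds[of P] assms by auto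
  obtain c d where cd: "c \<le> d" and Q: "root_strip Q = strip (ereal c) (ereal d)"
    and rQ: "\<And>r. poly Q r = 0 \<Longrightarrow> c \<le> Re r \<and> Re r \<le> d"
    using bounds[of Q] assms by auto
  define h where "h = (real n - 1) / 2"
  have ne: "P \<noteq> 0" "Q \<noteq> 0" using assms by auto
  have up: "Re z \<le> b + d - h" if "poly (diff_conv n P Q) z = 0" for z
    using diff_conv_nonzero[of 1 P n Q b d z] assms ne rP rQ that by (force simp: h_def)
  have lo: "a + c - h \<le> Re z" if z: "poly (diff_conv n P Q) z = 0" for z
  proof (rule ccontr)
    assume "\<not> ?thesis"
    \<comment> \<open>The left side is the case s = -1, where the left endpoints enter as upper
      bounds -a and -c.\<close>
    then have "-a + -c - -1 * (real n - 1) / 2 < -1 * Re z"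
      by (simp add: h_def field_simps)
    then have "poly (diff_conv n P Q) z \<noteq> 0"
      using diff_conv_nonzero[of "-1" P n Q "-a" "-c" z] assms ne rP rQ by simp
    with z show False by simp
  qed
  \<comment> \<open>As an intersection, \<open>root_strip\<close> lies in every strip containing the
    roots, so \<open>up\<close> and \<open>lo\<close> suffice.\<close>
  have "root_strip (diff_conv n P Q) \<subseteq> strip (ereal (a + c - h)) (ereal (b + d - h))"
    unfolding root_strip_def
  proof (rule Inter_lower, rule CollectI, intro exI conjI)
    show "ereal (a + c - h) \<le> ereal (b + d - h)" using ab cd by simp
    show "{z. poly (diff_conv n P Q) z = 0} \<subseteq>
        strip (ereal (a + c - h)) (ereal (b + d - h))"
      using up lo by (auto simp: strip_def)
  qed (rule refl)
  also have "\<dots> \<subseteq> (\<lambda>z. z - of_real h) ` strip (ereal (a + c)) (ereal (b + d))"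
  proof
    fix z assume "z \<in> strip (ereal (a + c - h)) (ereal (b + d - h))"
    then show "z \<in> (\<lambda>z. z - of_real h) ` strip (ereal (a + c)) (ereal (b + d))"
      by (intro image_eqI[of _ _ "z + of_real h"]) (auto simp: strip_def)
  qed
  also have "\<dots> \<subseteq> (\<lambda>z. z - of_real h) ` (root_strip P + root_strip Q)"
    unfolding P Q by (intro image_mono strip_add ab cd)
  finally show ?thesis unfolding h_def .
qed

end
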